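(* Let $n\ge1$ and let $a_{ij}$ ($i=0,\dots,n$, $j=1,\dots,n$) be positive integers with $a_{0j}\le a_{1j}\le\dots\le a_{n-1,j}$ for every $j$. Let $\mathcal{A}_i=\{b\in\mathbb{Z}^n:0\le b_j\le a_{ij}\ \forall j\}$, with the mixed subdivision $S(\rho)$, translation $\delta$, set $\mathcal{B}$, type vectors $t_b$, row contents $i(b)$ and $a(b)$ as described in the context. Let $\mathcal{G}=\{b\in\mathcal{B}:\sum_{i=0}^{I}t_{b,i}\le I+1\ \text{for all } I<n\}$. If $b\in\mathcal{G}$ and $b'\in\mathcal{B}\setminus\mathcal{G}$, then $b'\notin b-a(b)+\mathcal{A}_{i(b)}$.
   Context: $\Delta_i=\mathrm{conv}(\mathcal{A}_i)$, $\Delta=\sum_{i=0}^n\Delta_i$. Fix $v\in\mathbb{R}^n$ with $v_j<0$ for all $j$, and sufficiently small reals $\lambda_0>\dots>\lambda_n\ge0$; the lifting $\omega_i(x)=\lambda_i\langle v,x\rangle$ on $\mathcal{A}_i$ induces a coherent mixed subdivision $S(\rho)$ of $\Delta$ (cells are projections of lower faces of $\sum_i\mathrm{conv}\{(a,\omega_i(a))\}$, each cell $D$ having components $D=D_0+\dots+D_n$, $D_i$ a cell of the induced subdivision of $\Delta_i$). Fix $\delta\in\mathbb{R}^n$ with all coordinates negative and sufficiently small in absolute value (generic), and $\mathcal{B}=(\Delta+\delta)\cap\mathbb{Z}^n$. For $b\in\mathcal{B}$ lying in a translated $n$-cell $D+\delta$, $t_{b,i}=\dim D_i$ (so $\sum_i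 t_{b,i}=n$), $i(b)=\max\{i\in\{0,\dots,n\}:t_{b,i}=0\}$, and $a(b)\in\mathcal{A}_{i(b)}$ is the single point $D_{i(b)}$. *)

theory Defs
  imports "HOL-Analysis.Analysis" "HOL-Library.Set_Algebras"
begin

text \<open>
  The ambient dimension is \<open>n = CARD('n)\<close>.  The \<open>n + 1\<close> supports are a family
  \<open>A :: nat \<Rightarrow> (real^'n) set\<close> of which only the members \<open>A i\<close> with \<open>i \<le> n\<close> matter; the same
  holds for the liftings \<open>\<omega> i\<close>.  Sums of sets are Minkowski sums.
\<close>

definition integer_points :: "(real^'n) set" where
  "integer_points = {x. \<forall>j. x $ j \<in> \<int>}"

definition box_support :: "(nat \<Rightarrow> 'n \<Rightarrow> nat) \<Rightarrow> nat \<Rightarrow> (real^'n) set" where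
  "box_support a i = {b \<in> integer_points. \<forall>j. 0 \<le> b $ j \<and> b $ j \<le> real (a i j)}"

definition linear_lifting :: "(nat \<Rightarrow> real) \<Rightarrow> real^'n \<Rightarrow> nat \<Rightarrow> real^'n \<Rightarrow> real" where
  "linear_lifting lam v i x = lam i * (v \<bullet> x)"


subsection \<open>Coherent mixed subdivisions\<close>

definition lifted_polytope ::
  "(nat \<Rightarrow> (real^'n) set) \<Rightarrow> (nat \<Rightarrow> real^'n \<Rightarrow> real) \<Rightarrow> nat \<Rightarrow> ((real^'n) \<times> real) set" where
  "lifted_polytope A \<omega> i = convex hull ((\<lambda>x. (x, \<omega> i x)) ` A i)"

text \<open>
  The lower faces of a polytope in \<open>\<real>\<^sup>n \<times> \<real>\<close> are the faces minimising a linear functional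
  with positive last coefficient, which is normalised to \<open>1\<close> here.
\<close>

definition lower_face :: "real^'n \<Rightarrow> ((real^'n) \<times> real) set \<Rightarrow> ((real^'n) \<times> real) set" where
  "lower_face w P = {p \<in> P. \<forall>q \<in> P. (w, 1) \<bullet> p \<le> (w, 1) \<bullet> q}"

text \<open>
  A cell is recorded as a pair \<open>(D, C)\<close>: \<open>D\<close> is the projection of a lower face of the sum of the
  lifted polytopes and \<open>C i\<close>, for \<open>i \<le> n\<close>, is its component \<open>D\<^sub>i\<close>, the projection of the face of
  the \<open>i\<close>-th lifted polytope selected by the same functional; thus \<open>D = C 0 + \<dots> + C n\<close>.
  The \<open>restrict\<close> makes \<open>C\<close> independent of the irrelevant indices \<open>i > n\<close>.
\<close>

definition mixed_subdivision ::
  "(nat \<Rightarrow> (real^'n) set) \<Rightarrow> (nat \<Rightarrow> real^'n \<Rightarrow> real) \<Rightarrow>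
   ((real^'n) set \<times> (nat \<Rightarrow> (real^'n) set)) set" where
  "mixed_subdivision A \<omega> =
     {(fst ` lower_face w (\<Sum>i\<le>CARD('n). lifted_polytope A \<omega> i),
       restrict (\<lambda>i. fst ` lower_face w (lifted_polytope A \<omega> i)) {..CARD('n)}) | w. True}"

definition full_cells ::
  "(nat \<Rightarrow> (real^'n) set) \<Rightarrow> (nat \<Rightarrow> real^'n \<Rightarrow> real) \<Rightarrow>
   ((real^'n) set \<times> (nat \<Rightarrow> (real^'n) set)) set" where
  "full_cells A \<omega> = {(D, C) \<in> mixed_subdivision A \<omega>. aff_dim D = int CARD('n)}"

definition translate :: "real^'n \<Rightarrow> (real^'n) set \<Rightarrow> (real^'n) set" where
  "translate \<delta> S = (\<lambda>x. x + \<delta>) ` S"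

text \<open>
  Genericity of the shift: no lattice point lies on the boundary of a translated \<open>n\<close>-cell, so that
  every lattice point of the shifted polytope lies in exactly one translated \<open>n\<close>-cell.
\<close>

definition generic_shift ::
  "(nat \<Rightarrow> (real^'n) set) \<Rightarrow> (nat \<Rightarrow> real^'n \<Rightarrow> real) \<Rightarrow> real^'n \<Rightarrow> bool" where
  "generic_shift A \<omega> \<delta> \<longleftrightarrow>
     (\<forall>(D, C) \<in> full_cells A \<omega>. frontier (translate \<delta> D) \<inter> integer_points = {})"


subsection \<open>Lattice points, type vectors and row contents\<close>

definition shifted_points :: "(nat \<Rightarrow> (real^'n) set) \<Rightarrow> real^'n \<Rightarrow> (real^'n) set" where
  "shifted_points A \<delta> = translate \<delta> (\<Sum>i\<le>CARD('n). convex hull (A i)) \<inter> integer_points"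

definition components_at ::
  "(nat \<Rightarrow> (real^'n) set) \<Rightarrow> (nat \<Rightarrow> real^'n \<Rightarrow> real) \<Rightarrow> real^'n \<Rightarrow> real^'n \<Rightarrow>
   nat \<Rightarrow> (real^'n) set" where
  "components_at A \<omega> \<delta> b =
     snd (THE (D, C). (D, C) \<in> full_cells A \<omega> \<and> b \<in> translate \<delta> D)"

definition type_vector ::
  "(nat \<Rightarrow> (real^'n) set) \<Rightarrow> (nat \<Rightarrow> real^'n \<Rightarrow> real) \<Rightarrow> real^'n \<Rightarrow> real^'n \<Rightarrow> nat \<Rightarrow> int" where
  "type_vector A \<omega> \<delta> b i = aff_dim (components_at A \<omega> \<delta> b i)"

definition row_index ::
  "(nat \<Rightarrow> (real^'n) set) \<Rightarrow> (nat \<Rightarrow> real^'n \<Rightarrow> real) \<Rightarrow> real^'n \<Rightarrow> real^'n \<Rightarrow> nat" where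
  "row_index A \<omega> \<delta> b = Max {i \<in> {0..CARD('n)}. type_vector A \<omega> \<delta> b i = 0}"

definition row_point ::
  "(nat \<Rightarrow> (real^'n) set) \<Rightarrow> (nat \<Rightarrow> real^'n \<Rightarrow> real) \<Rightarrow> real^'n \<Rightarrow> real^'n \<Rightarrow> real^'n" where
  "row_point A \<omega> \<delta> b = (THE x. components_at A \<omega> \<delta> b (row_index A \<omega> \<delta> b) = {x})"

definition greedy_points ::
  "(nat \<Rightarrow> (real^'n) set) \<Rightarrow> (nat \<Rightarrow> real^'n \<Rightarrow> real) \<Rightarrow> real^'n \<Rightarrow> (real^'n) set" where
  "greedy_points A \<omega> \<delta> =
     {b \<in> shifted_points A \<delta>.
        \<forall>I < CARD('n). (\<Sum>i=0..I. type_vector A \<omega> \<delta> b i) \<le> int I + 1}"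

end

theory Submission
  imports Defs
begin

text \<open>
  Since the liftings are linear, every face is a box, computed one coordinate at a time: in
  coordinate \<open>j\<close> the functional \<open>w\<close> acts on the \<open>i\<close>-th support with slope \<open>w\<^sub>j + \<lambda>\<^sub>i v\<^sub>j\<close>, which is strictly
  increasing in \<open>i\<close>. Hence the \<open>n\<close>-cells correspond to the maps \<open>k\<close> from coordinates to
  \<open>{0..n}\<close>: coordinate \<open>j\<close> of the cell is the \<open>k j\<close>-th of the consecutive segments of lengths
  \<open>a\<^sub>0\<^sub>j, a\<^sub>1\<^sub>j, \<dots>\<close>, and \<open>t\<^sub>b\<^sub>,\<^sub>i\<close> counts the coordinates \<open>j\<close> with \<open>k j = i\<close>. Let \<open>r\<close> be the row index of
  \<open>b\<close>. A move from \<open>b\<close> within row \<open>r\<close> does not lower \<open>k j\<close> if \<open>k j < r\<close>, and by monotonicity of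
  \<open>a\<close> lowers it by at most one if \<open>k j > r\<close>. As \<open>t\<^sub>b\<^sub>,\<^sub>i \<ge> 1\<close> for \<open>i > r\<close>, the greedy inequalities
  survive the move.
\<close>

section \<open>Boxes and lower faces\<close>

lemma sum_cbox_cart:
  fixes l u :: "'i \<Rightarrow> real^'n::finite"
  assumes "finite I" and "\<And>i j. i \<in> I \<Longrightarrow> l i $ j \<le> u i $ j"
  shows "(\<Sum>i\<in>I. cbox (l i) (u i)) = cbox (\<Sum>i\<in>I. l i) (\<Sum>i\<in>I. u i)"
  using assms
proof (induction I rule: finite_induct)
  case empty
  then show ?case by (simp add: set_zero)
next
  case (insert x F)
  let ?L = "\<Sum>i\<in>F. l i" and ?U = "\<Sum>i\<in>F. u i"
  have LU: "?L $ j \<le> ?U $ j" for j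
    using insert.prems by (auto simp: sum_component intro!: sum_mono)
  have lu: "l x $ j \<le> u x $ j" for j
    using insert.prems by auto
  have "cbox (l x) (u x) + cbox ?L ?U = cbox (l x + ?L) (u x + ?U)"
  proof (intro equalityI subsetI)
    fix z assume "z \<in> cbox (l x) (u x) + cbox ?L ?U"
    then show "z \<in> cbox (l x + ?L) (u x + ?U)"
      by (auto simp: mem_box_cart set_plus_def simp del: sum_component intro!: add_mono)
  next
    fix z assume "z \<in> cbox (l x + ?L) (u x + ?U)"
    then have z: "l x $ j + ?L $ j \<le> z $ j \<and> z $ j \<le> u x $ j + ?U $ j" for j
      by (auto simp: mem_box_cart simp del: sum_component)
    \<comment> \<open>\<open>p\<close> is the least point of the first box whose complement
      \<open>z - p\<close> stays below \<open>?U\<close>; the two arguments of the maximum express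
      these two demands.\<close>
    define p where "p = (\<chi> j. max (l x $ j) (z $ j - ?U $ j))"
    have p: "p $ j = max (l x $ j) (z $ j - ?U $ j)" for j
      by (simp add: p_def)
    have "p \<in> cbox (l x) (u x)"
      unfolding mem_box_cart p using z lu by (auto simp: algebra_simps simp del: sum_component)
    moreover have "z - p \<in> cbox ?L ?U"
      unfolding mem_box_cart vector_minus_component p
    proof
      fix j
      show "?L $ j \<le> z $ j - max (l x $ j) (z $ j - ?U $ j) \<and>
          z $ j - max (l x $ j) (z $ j - ?U $ j) \<le> ?U $ j"
        using z[of j] LU[of j] by linarith
    qed
    ultimately have "p + (z - p) \<in> cbox (l x) (u x) + cbox ?L ?U"
      by (rule set_plus_intro)
    then show "z \<in> cbox (l x) (u x) + cbox ?L ?U"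
      by simp
  qed
  then show ?case
    using insert by simp
qed

text \<open>Moving the lower corner to the origin turns the affine dimension into a linear one. The
  moved box spans the same space as the axes along which it has positive length.\<close>

lemma aff_dim_cbox_cart:
  fixes l u :: "real^'n::finite"
  assumes "\<And>j. l $ j \<le> u $ j"
  shows "aff_dim (cbox l u) = int (card {j. l $ j < u $ j})"
proof -
  let ?d = "u - l" and ?J = "{j. l $ j < u $ j}"
  let ?E = "(\<lambda>j. axis j (1::real)) ` ?J"
  let ?T = "{x::real^'n. \<forall>i\<in>Basis. i \<notin> ?E \<longrightarrow> x \<bullet> i = 0}"
  have E: "?E \<subseteq> Basis"
    by (auto simp: Basis_vec_def)
  have "cbox l u = (+) l ` cbox 0 ?d"
  proof (intro equalityI subsetI)
    fix x assume "x \<in> cbox l u"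
    then have "x - l \<in> cbox 0 ?d"
      by (auto simp: mem_box_cart)
    then show "x \<in> (+) l ` cbox 0 ?d"
      by (intro image_eqI[of _ _ "x - l"]) auto
  next
    fix x assume "x \<in> (+) l ` cbox 0 ?d"
    then obtain y where x: "x = l + y" and y: "\<And>j. 0 \<le> y $ j \<and> y $ j \<le> u $ j - l $ j"
      by (auto simp: mem_box_cart)
    show "x \<in> cbox l u"
      unfolding mem_box_cart x vector_add_component
    proof
      fix j
      show "l $ j \<le> l $ j + y $ j \<and> l $ j + y $ j \<le> u $ j"
        using y[of j] by linarith
    qed
  qed
  then have "aff_dim (cbox l u) = aff_dim (cbox 0 ?d)"
    by (simp add: aff_dim_translation_eq)
  also have "\<dots> = int (dim (cbox 0 ?d))"
    using assms by (intro aff_dim_zero hull_inc) (auto simp: mem_box_cart)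
  also have "dim (cbox 0 ?d) = dim ?E"
  proof (rule span_eq_dim, rule subset_antisym)
    have "x \<in> span ?E" if "x \<in> cbox 0 ?d" for x
    proof -
      have "x = (\<Sum>j\<in>UNIV. x $ j *\<^sub>R axis j 1)"
        by (simp add: vec_eq_iff sum_component axis_def if_distrib[of "\<lambda>t. _ * t"] cong: if_cong)
      moreover have "x $ j *\<^sub>R axis j 1 \<in> span ?E" for j
      proof (cases "j \<in> ?J")
        case True
        then show ?thesis by (intro span_scale span_base) auto
      next
        case False
        then have "x $ j = 0"
          using that by (simp add: mem_box_cart) (smt (verit))
        then show ?thesis by (simp add: span_zero)
      qed
      ultimately show ?thesis
        by (metis (no_types, lifting) span_sum)
    qed
    then show "span (cbox 0 ?d) \<subseteq> span ?E"
      by (intro span_minimal) auto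
  next
    have "axis j 1 \<in> span (cbox 0 ?d)" if "l $ j < u $ j" for j
    proof -
      have "?d $ j *\<^sub>R axis j 1 \<in> cbox 0 ?d"
        using assms by (auto simp: mem_box_cart axis_def)
      then have "(1 / ?d $ j) *\<^sub>R (?d $ j *\<^sub>R axis j 1) \<in> span (cbox 0 ?d)"
        by (intro span_scale span_base)
      then show ?thesis using that by simp
    qed
    then show "span ?E \<subseteq> span (cbox 0 ?d)"
      by (intro span_minimal) auto
  qed
  also have "dim ?E = card ?E"
    by (intro dim_eq_card_independent independent_mono[OF independent_Basis E])
  also have "card ?E = card ?J"
    by (rule card_image) (auto simp: inj_on_def axis_eq_axis)
  finally show ?thesis .
qed

text \<open>A linear functional on a box is minimised in each coordinate separately. The sign of
  \<open>c $ j\<close> selects the upper end, the lower end or, for zero, the whole edge.\<close>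

lemma minimal_face_cbox:
  fixes c u :: "real^'n::finite"
  assumes u: "\<And>j. 0 \<le> u $ j"
  shows "{x \<in> cbox 0 u. \<forall>y \<in> cbox 0 u. c \<bullet> x \<le> c \<bullet> y} =
    cbox (\<chi> j. if c $ j < 0 then u $ j else 0) (\<chi> j. if c $ j > 0 then 0 else u $ j)"
    (is "?F = ?B")
proof (intro equalityI subsetI)
  fix x assume x: "x \<in> ?F"
  then have box: "0 \<le> x $ j \<and> x $ j \<le> u $ j" for j
    by (auto simp: mem_box_cart)
  have min: "c $ j * x $ j \<le> c $ j * t" if "0 \<le> t" "t \<le> u $ j" for j t
  proof -
    \<comment> \<open>Changing only coordinate \<open>j\<close> of \<open>x\<close> to
      \<open>t\<close> stays in the box and isolates the term of \<open>c $ j\<close>; the two ends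
      of the edge are then tested as \<open>t\<close>.\<close>
    have "x + axis j (t - x $ j) \<in> cbox 0 u"
      using box that by (auto simp: mem_box_cart axis_def)
    then have "c \<bullet> x \<le> c \<bullet> (x + axis j (t - x $ j))"
      using x by blast
    then show ?thesis
      by (simp add: inner_add_right inner_axis algebra_simps)
  qed
  have "(if c $ j < 0 then u $ j else 0) \<le> x $ j \<and> x $ j \<le> (if c $ j > 0 then 0 else u $ j)" for j
    using box[of j] min[of 0 j] min[of "u $ j" j] u[of j]
    by (auto simp: mult_le_0_iff mult_le_cancel_left)
  then show "x \<in> ?B"
    by (simp add: mem_box_cart)
next
  fix x assume "x \<in> ?B"
  then have x: "(if c $ j < 0 then u $ j else 0) \<le> x $ j \<and>
      x $ j \<le> (if c $ j > 0 then 0 else u $ j)" for j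
    by (simp add: mem_box_cart)
  have "0 \<le> x $ j \<and> x $ j \<le> u $ j" for j
    using x[of j] u[of j] by (auto split: if_splits)
  moreover have "c \<bullet> x \<le> c \<bullet> y" if "y \<in> cbox 0 u" for y
    unfolding inner_vec_def inner_real_def
  proof (rule sum_mono)
    fix j
    have "0 \<le> y $ j \<and> y $ j \<le> u $ j"
      using that by (simp add: mem_box_cart)
    then show "c $ j * x $ j \<le> c $ j * y $ j"
      using x[of j] by (auto simp: mult_le_cancel_left split: if_splits)
  qed
  ultimately show "x \<in> ?F"
    by (simp add: mem_box_cart)
qed

section \<open>Lower faces of Minkowski sums and of lifted boxes\<close>

lemma lower_face_sum:
  assumes "finite I"
  shows "lower_face w (\<Sum>i\<in>I. P i) = (\<Sum>i\<in>I. lower_face w (P i))"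
proof (intro equalityI subsetI)
  fix p assume p: "p \<in> lower_face w (\<Sum>i\<in>I. P i)"
  then obtain s where s: "p = sum s I" "\<forall>i\<in>I. s i \<in> P i"
    by (auto simp: lower_face_def set_sum_alt[OF assms])
  have "s i \<in> lower_face w (P i)" if i: "i \<in> I" for i
    unfolding lower_face_def
  proof (intro CollectI conjI ballI)
    show "s i \<in> P i" using s i by blast
    fix q assume q: "q \<in> P i"
    \<comment> \<open>Exchange argument: replacing \<open>s i\<close> by \<open>q\<close> changes a
      single term of the functional, so a minimal sum has minimal summands.\<close>
    have "sum (s(i := q)) I \<in> (\<Sum>i\<in>I. P i)"
      unfolding set_sum_alt[OF assms] using s q by fastforce
    then have "(w, 1) \<bullet> sum s I \<le> (w, 1) \<bullet> sum (s(i := q)) I"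
      using p s by (auto simp: lower_face_def)
    moreover have "sum (s(i := q)) I = q + sum s (I - {i})"
      using assms i by (subst sum.remove[of I i]) (auto intro!: sum.cong)
    moreover have "sum s I = s i + sum s (I - {i})"
      using assms i by (rule sum.remove)
    ultimately show "(w, 1) \<bullet> s i \<le> (w, 1) \<bullet> q"
      by (simp only: inner_add_right add_le_cancel_right)
  qed
  then show "p \<in> (\<Sum>i\<in>I. lower_face w (P i))"
    unfolding set_sum_alt[OF assms] using s by blast
next
  fix p assume "p \<in> (\<Sum>i\<in>I. lower_face w (P i))"
  then obtain s where s: "p = sum s I" "\<forall>i\<in>I. s i \<in> lower_face w (P i)"
    by (auto simp: set_sum_alt[OF assms])
  show "p \<in> lower_face w (\<Sum>i\<in>I. P i)"
    unfolding lower_face_def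
  proof (intro CollectI conjI ballI)
    show "p \<in> (\<Sum>i\<in>I. P i)"
      unfolding set_sum_alt[OF assms] using s by (auto simp: lower_face_def)
    fix q assume "q \<in> (\<Sum>i\<in>I. P i)"
    then obtain t where "q = sum t I" "\<forall>i\<in>I. t i \<in> P i"
      by (auto simp: set_sum_alt[OF assms])
    then show "(w, 1) \<bullet> p \<le> (w, 1) \<bullet> q"
      using s by (auto simp: inner_sum_right lower_face_def intro!: sum_mono)
  qed
qed

lemma fst_image_sum:
  assumes "finite I"
  shows "fst ` (\<Sum>i\<in>I. P i) = (\<Sum>i\<in>I. fst ` P i)"
  using assms
proof (induction I rule: finite_induct)
  case empty
  then show ?case by (simp add: set_zero)
next
  case (insert x F)
  have "fst ` (P x + Q) = fst ` P x + fst ` Q" for Q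
    by (force simp: set_plus_def)
  then show ?case using insert by simp
qed

lemma convex_hull_box_support:
  fixes a :: "nat \<Rightarrow> 'n::finite \<Rightarrow> nat"
  shows "convex hull (box_support a i) = cbox 0 (\<chi> j. real (a i j))"
proof
  show "convex hull (box_support a i) \<subseteq> cbox 0 (\<chi> j. real (a i j))"
    by (intro hull_minimal convex_box) (auto simp: box_support_def mem_box_cart)
  \<comment> \<open>The unit cube is the hull of its 0-1 vertices. Scaling axis \<open>j\<close> by
    \<open>a i j\<close> carries it onto the box and its vertices to lattice points of the
    support.\<close>
  let ?f = "\<lambda>x::real^'n. (\<chi> j. real (a i j) * x $ j) :: real^'n"
  have "linear ?f"
    by (intro linearI) (auto simp: vec_eq_iff algebra_simps)
  have unit: "cbox 0 1 = convex hull {x::real^'n. \<forall>j. x $ j = 0 \<or> x $ j = 1}"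
  proof -
    have "{x::real^'n. \<forall>b\<in>Basis. x \<bullet> b = 0 \<or> x \<bullet> b = 1} = {x. \<forall>j. x $ j = 0 \<or> x $ j = 1}"
      by (auto simp: Basis_vec_def inner_axis)
    moreover have "(\<Sum>Basis :: real^'n) = 1"
      by (simp add: vec_eq_iff const_vector_cart[of 1, simplified, symmetric])
    ultimately show ?thesis
      using unit_interval_convex_hull[where 'a = "real^'n"] by simp
  qed
  have "cbox 0 (\<chi> j. real (a i j)) \<subseteq> ?f ` cbox 0 1"
  proof
    fix x :: "real^'n" assume x: "x \<in> cbox 0 (\<chi> j. real (a i j))"
    \<comment> \<open>Where \<open>a i j = 0\<close> the coordinate of \<open>x\<close> vanishes
      too, so the preimage can be 0 there.\<close>
    let ?y = "(\<chi> j. if a i j = 0 then 0 else x $ j / real (a i j)) :: real^'n"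
    have "x = ?f ?y"
      using x unfolding vec_eq_iff by (auto simp: mem_box_cart) (metis of_nat_0 order_antisym)
    moreover have "?y \<in> cbox 0 1"
      using x by (auto simp: mem_box_cart divide_simps)
    ultimately show "x \<in> ?f ` cbox 0 1"
      by (rule image_eqI)
  qed
  also have "\<dots> = convex hull (?f ` {x. \<forall>j. x $ j = 0 \<or> x $ j = 1})"
    unfolding unit by (rule convex_hull_linear_image[OF \<open>linear ?f\<close>])
  also have "\<dots> \<subseteq> convex hull (box_support a i)"
  proof (intro hull_mono subsetI)
    fix y assume "y \<in> ?f ` {x. \<forall>j. x $ j = 0 \<or> x $ j = 1}"
    then obtain x where x: "\<And>j. x $ j = 0 \<or> x $ j = 1" and y: "y = ?f x"
      by auto
    have "y $ j = 0 \<or> y $ j = real (a i j)" for j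
      using x[of j] by (auto simp: y)
    then show "y \<in> box_support a i"
      unfolding box_support_def integer_points_def
      by (auto; metis Ints_0 Ints_of_nat order_refl of_nat_0_le_iff)
  qed
  finally show "cbox 0 (\<chi> j. real (a i j)) \<subseteq> convex hull (box_support a i)" .
qed

text \<open>The lifted polytope is the graph of a linear function over the box, so its lower face
  projects to the face of the box minimising \<open>w + lam i *\<^sub>R v\<close>.\<close>

lemma fst_lower_face_box:
  fixes a :: "nat \<Rightarrow> 'n::finite \<Rightarrow> nat" and v w :: "real^'n" and lam :: "nat \<Rightarrow> real"
  defines "c \<equiv> \<lambda>i j. w $ j + lam i * v $ j"
  shows "fst ` lower_face w (lifted_polytope (box_support a) (linear_lifting lam v) i) =
    cbox (\<chi> j. if c i j < 0 then real (a i j) else 0) (\<chi> j. if c i j > 0 then 0 else real (a i j))"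
proof -
  let ?g = "\<lambda>x. (x, lam i * (v \<bullet> x))" and ?K = "cbox 0 (\<chi> j. real (a i j)) :: (real^'n) set"
  have "linear ?g"
    by (intro linearI) (auto simp: inner_add_right algebra_simps)
  then have P: "lifted_polytope (box_support a) (linear_lifting lam v) i = ?g ` ?K"
    unfolding lifted_polytope_def linear_lifting_def
    by (simp add: convex_hull_linear_image[symmetric] convex_hull_box_support)
  have "(w, 1) \<bullet> ?g x = (w + lam i *\<^sub>R v) \<bullet> x" for x
    by (simp add: inner_add_left)
  then have "fst ` lower_face w (?g ` ?K) =
      {x \<in> ?K. \<forall>y \<in> ?K. (w + lam i *\<^sub>R v) \<bullet> x \<le> (w + lam i *\<^sub>R v) \<bullet> y}"
    unfolding lower_face_def by (force simp: image_iff)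
  also have "\<dots> = cbox (\<chi> j. if c i j < 0 then real (a i j) else 0)
      (\<chi> j. if c i j > 0 then 0 else real (a i j))"
    by (subst minimal_face_cbox) (simp_all add: c_def cong: if_cong)
  finally show ?thesis by (simp add: P)
qed


section \<open>The cells of the mixed subdivision\<close>

locale box_subdivision =
  fixes a :: "nat \<Rightarrow> 'n::finite \<Rightarrow> nat" and v :: "real^'n" and lam :: "nat \<Rightarrow> real"
  assumes a_pos: "\<And>i j. i \<le> CARD('n) \<Longrightarrow> 0 < a i j"
    and v_neg: "\<And>j. v $ j < 0"
    and lam_decreasing: "\<And>i. i < CARD('n) \<Longrightarrow> lam (Suc i) < lam i"
begin

abbreviation A :: "nat \<Rightarrow> (real^'n) set" where
  "A \<equiv> box_support a"

abbreviation \<omega> :: "nat \<Rightarrow> real^'n \<Rightarrow> real" where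
  "\<omega> \<equiv> linear_lifting lam v"

text \<open>Breakpoints on axis \<open>j\<close>: they cut the edge of the total box into
  consecutive segments, the \<open>m\<close>-th (counted from 0) having length
  \<open>a m j\<close>.\<close>

definition partial :: "nat \<Rightarrow> 'n \<Rightarrow> nat" where
  "partial m j = (\<Sum>i<m. a i j)"

text \<open>\<open>k j\<close> is the support that contributes a whole edge in direction
  \<open>j\<close>; supports before it sit at their upper end, supports after it at 0.\<close>

definition component :: "('n \<Rightarrow> nat) \<Rightarrow> nat \<Rightarrow> (real^'n) set" where
  "component k i = cbox (\<chi> j. if i < k j then real (a i j) else 0)
                        (\<chi> j. if k j < i then 0 else real (a i j))"

definition cell :: "('n \<Rightarrow> nat) \<Rightarrow> (real^'n) set" where
  "cell k = cbox (\<chi> j. real (partial (k j) j)) (\<chi> j. real (partial (Suc (k j)) j))"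

lemma partial_Suc: "partial (Suc m) j = partial m j + a m j"
  by (simp add: partial_def)

lemma partial_mono: "m \<le> m' \<Longrightarrow> partial m j \<le> partial m' j"
  unfolding partial_def by (rule sum_mono2) auto

lemma lam_strict: "i < k \<Longrightarrow> k \<le> CARD('n) \<Longrightarrow> lam k < lam i"
proof (induction k)
  case (Suc k)
  then show ?case
    using lam_decreasing[of k] by (cases "i = k") auto
qed simp

text \<open>\<open>lam\<close> decreases and \<open>v $ j\<close> is negative, so their products
  increase with the index. Hence at most one support has slope 0 in a given coordinate.\<close>

lemma slope_strict:
  assumes "i < k" "k \<le> CARD('n)"
  shows "x + lam i * v $ j < x + lam k * v $ j"
  using mult_strict_right_mono_neg[OF lam_strict[OF assms] v_neg[of j]] by simp

lemma sum_component_eq_cell: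
  assumes k: "\<And>j. k j \<le> CARD('n)"
  shows "(\<Sum>i\<le>CARD('n). component k i) = cell k"
proof -
  \<comment> \<open>The lower ends add up the lengths of the segments before \<open>k j\<close>; the
    upper ends below include segment \<open>k j\<close> itself.\<close>
  have lo: "(\<Sum>i\<le>CARD('n). if i < k j then real (a i j) else 0) = real (partial (k j) j)" for j
  proof -
    have "{..CARD('n)} \<inter> {i. i < k j} = {..<k j}"
      using k[of j] by auto
    then show ?thesis by (simp add: partial_def sum.If_cases)
  qed
  have hi: "(\<Sum>i\<le>CARD('n). if k j < i then 0 else real (a i j)) = real (partial (Suc (k j)) j)" for j
  proof -
    have "{..CARD('n)} \<inter> - {i. k j < i} = {..<Suc (k j)}"
      using k[of j] by auto
    then show ?thesis by (simp add: partial_def sum.If_cases)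
  qed
  show ?thesis
    unfolding component_def cell_def
    by (subst sum_cbox_cart) (auto simp: vec_eq_iff lo hi intro!: arg_cong2[of _ _ _ _ cbox])
qed

text \<open>Increasing slopes that vanish at \<open>k j\<close> are negative before it and positive
  after it, which is the pattern of ends in \<open>component\<close>.\<close>

lemma fst_lower_face_eq_component:
  assumes "\<And>j. k j \<le> CARD('n)" and "\<And>j. w $ j + lam (k j) * v $ j = 0" and i: "i \<le> CARD('n)"
  shows "fst ` lower_face w (lifted_polytope A \<omega> i) = component k i"
proof -
  have lt: "w $ j + lam i * v $ j < 0 \<longleftrightarrow> i < k j" and gt: "w $ j + lam i * v $ j > 0 \<longleftrightarrow> k j < i" for j
    using assms(1,2)[of j] i slope_strict[of i "k j" "w $ j" j] slope_strict[of "k j" i "w $ j" j]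
    by (cases i "k j" rule: linorder_cases; simp)+
  show ?thesis
    by (simp add: fst_lower_face_box component_def lt gt)
qed

lemma fst_lower_face_total:
  "fst ` lower_face w (\<Sum>i\<le>CARD('n). lifted_polytope A \<omega> i) =
    (\<Sum>i\<le>CARD('n). fst ` lower_face w (lifted_polytope A \<omega> i))"
  by (simp add: lower_face_sum fst_image_sum)

lemma full_cells_eq:
  "full_cells A \<omega> = {(cell k, restrict (component k) {..CARD('n)}) | k. \<forall>j. k j \<le> CARD('n)}"
proof (intro equalityI subsetI)
  fix X assume "X \<in> full_cells A \<omega>"
  then obtain w where
    X: "X = (fst ` lower_face w (\<Sum>i\<le>CARD('n). lifted_polytope A \<omega> i),
       restrict (\<lambda>i. fst ` lower_face w (lifted_polytope A \<omega> i)) {..CARD('n)})"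
    and dim: "aff_dim (fst X) = int CARD('n)"
    by (auto simp: full_cells_def mixed_subdivision_def)
  let ?c = "\<lambda>i j. w $ j + lam i * v $ j"
  let ?l = "\<lambda>i. (\<chi> j. if ?c i j < 0 then real (a i j) else 0) :: real^'n"
  let ?u = "\<lambda>i. (\<chi> j. if ?c i j > 0 then 0 else real (a i j)) :: real^'n"
  let ?L = "\<Sum>i\<le>CARD('n). ?l i" and ?U = "\<Sum>i\<le>CARD('n). ?u i"
  have "fst X = cbox ?L ?U"
    unfolding X fst_conv fst_lower_face_total fst_lower_face_box
    by (subst sum_cbox_cart) auto
  moreover have "?L $ j \<le> ?U $ j" for j
    by (auto simp: sum_component intro!: sum_mono)
  ultimately have "card {j. ?L $ j < ?U $ j} = CARD('n)"
    using dim aff_dim_cbox_cart[of ?L ?U] by simp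
  then have all: "?L $ j < ?U $ j" for j
    using card_subset_eq[of UNIV "{j. ?L $ j < ?U $ j}"] by auto
  \<comment> \<open>A nonzero slope collapses a support to one end in direction \<open>j\<close>, so
    positive total length needs a slope equal to 0.\<close>
  have "\<exists>i\<le>CARD('n). ?c i j = 0" for j
  proof (rule ccontr)
    assume neg: "\<not> ?thesis"
    have "?L $ j = ?U $ j"
      unfolding sum_component using neg by (intro sum.cong) auto
    with all[of j] show False by simp
  qed
  then obtain k where k: "\<And>j. k j \<le> CARD('n)" "\<And>j. ?c (k j) j = 0"
    by metis
  have "X = (cell k, restrict (component k) {..CARD('n)})"
    unfolding X fst_lower_face_total
    using fst_lower_face_eq_component[OF k] sum_component_eq_cell[of k] k(1)
    by (auto intro!: restrict_ext)
  with k(1) show "X \<in> {(cell k, restrict (component k) {..CARD('n)}) | k. \<forall>j. k j \<le> CARD('n)}"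
    by auto
next
  fix X assume "X \<in> {(cell k, restrict (component k) {..CARD('n)}) | k. \<forall>j. k j \<le> CARD('n)}"
  then obtain k where k: "\<And>j. k j \<le> CARD('n)"
    and X: "X = (cell k, restrict (component k) {..CARD('n)})"
    by auto
  \<comment> \<open>Every \<open>k\<close> is realised: the coordinates of \<open>w\<close> are
    independent, so each can cancel the slope of support \<open>k j\<close>.\<close>
  define w :: "real^'n" where "w = (\<chi> j. - lam (k j) * v $ j)"
  have w: "w $ j + lam (k j) * v $ j = 0" for j
    by (simp add: w_def)
  have "X = (fst ` lower_face w (\<Sum>i\<le>CARD('n). lifted_polytope A \<omega> i),
       restrict (\<lambda>i. fst ` lower_face w (lifted_polytope A \<omega> i)) {..CARD('n)})"
    unfolding X fst_lower_face_total
    using fst_lower_face_eq_component[OF k w] sum_component_eq_cell[of k] k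
    by (auto intro!: restrict_ext)
  moreover have "aff_dim (cell k) = int CARD('n)"
    unfolding cell_def using a_pos k by (subst aff_dim_cbox_cart) (auto simp: partial_Suc)
  ultimately show "X \<in> full_cells A \<omega>"
    unfolding full_cells_def mixed_subdivision_def using X by auto
qed


section \<open>Lattice points in the shifted cells\<close>

text \<open>Half-open slots, because a small negative shift of a cell keeps the lattice points at
  its lower ends and loses those at its upper ends.\<close>

definition in_slots :: "('n \<Rightarrow> nat) \<Rightarrow> real^'n \<Rightarrow> bool" where
  "in_slots k b \<longleftrightarrow> (\<forall>j. k j \<le> CARD('n) \<and>
     real (partial (k j) j) \<le> b $ j \<and> b $ j < real (partial (Suc (k j)) j))"

lemma in_slots_unique:
  assumes "in_slots k b" "in_slots k' b"
  shows "k = k'"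
proof
  fix j
  have "\<not> k j < k' j" if "in_slots k b" "in_slots k' b" for k k'
  proof
    assume "k j < k' j"
    then have "partial (Suc (k j)) j \<le> partial (k' j) j"
      by (intro partial_mono) simp
    moreover have "b $ j < real (partial (Suc (k j)) j)" "real (partial (k' j) j) \<le> b $ j"
      using that by (auto simp: in_slots_def)
    ultimately show False by linarith
  qed
  from this[OF assms] this[OF assms(2,1)] show "k j = k' j" by simp
qed

text \<open>Each coordinate of \<open>b - \<delta>\<close> exceeds an integer by an amount strictly
  between 0 and 1. Against integer bounds the lower inequality is unchanged and the upper one
  becomes strict.\<close>

lemma in_translate_iff:
  assumes b: "b \<in> integer_points" and \<delta>: "\<And>j. \<delta> $ j < 0 \<and> \<bar>\<delta> $ j\<bar> < 1"
  shows "b \<in> translate \<delta> (cbox (\<chi> j. real (l j)) (\<chi> j. real (u j))) \<longleftrightarrow>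
    (\<forall>j. real (l j) \<le> b $ j \<and> b $ j < real (u j))"
proof -
  have "b \<in> translate \<delta> S \<longleftrightarrow> b - \<delta> \<in> S" for S
    unfolding translate_def by (auto simp: image_iff) (metis diff_add_cancel)
  moreover have "real (l j) \<le> b $ j - \<delta> $ j \<and> b $ j - \<delta> $ j \<le> real (u j) \<longleftrightarrow>
      real (l j) \<le> b $ j \<and> b $ j < real (u j)" for j
  proof -
    obtain z where z: "b $ j = of_int z"
      using b by (auto simp: integer_points_def elim: Ints_cases)
    have "\<lfloor>b $ j - \<delta> $ j\<rfloor> = z" "\<lceil>b $ j - \<delta> $ j\<rceil> = z + 1"
      using \<delta>[of j] by (auto simp: z intro!: floor_unique ceiling_unique)
    then have "int (l j) \<le> z \<longleftrightarrow> real (l j) \<le> b $ j - \<delta> $ j"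
      and "z + 1 \<le> int (u j) \<longleftrightarrow> b $ j - \<delta> $ j \<le> real (u j)"
      using le_floor_iff[of "int (l j)" "b $ j - \<delta> $ j"]
        ceiling_le_iff[of "b $ j - \<delta> $ j" "int (u j)"] by auto
    moreover have "int (l j) \<le> z \<longleftrightarrow> real (l j) \<le> b $ j" "z + 1 \<le> int (u j) \<longleftrightarrow> b $ j < real (u j)"
      unfolding z by linarith+
    ultimately show ?thesis by blast
  qed
  ultimately show ?thesis
    by (simp add: mem_box_cart)
qed

lemma shifted_points_in_slots:
  assumes b: "b \<in> shifted_points A \<delta>" and \<delta>: "\<And>j. \<delta> $ j < 0 \<and> \<bar>\<delta> $ j\<bar> < 1"
  obtains k where "in_slots k b"
proof -
  have "(\<Sum>i\<le>CARD('n). convex hull (A i)) =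
      cbox (\<chi> j. real 0) (\<chi> j. real (partial (Suc CARD('n)) j))"
    unfolding convex_hull_box_support
    by (subst sum_cbox_cart)
      (auto simp: vec_eq_iff partial_def lessThan_Suc_atMost intro!: arg_cong2[of _ _ _ _ cbox])
  then have range: "0 \<le> b $ j \<and> b $ j < real (partial (Suc CARD('n)) j)" for j
    using b in_translate_iff[of b \<delta> "\<lambda>_. 0" "partial (Suc CARD('n))"] \<delta>
    by (auto simp: shifted_points_def)
  \<comment> \<open>The first segment whose upper end exceeds \<open>b $ j\<close>; by minimality
    its lower end, the upper end of the preceding segment, does not.\<close>
  define k where "k j = (LEAST m. b $ j < real (partial (Suc m) j))" for j
  have "k j \<le> CARD('n) \<and> real (partial (k j) j) \<le> b $ j \<and> b $ j < real (partial (Suc (k j)) j)" for j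
  proof (intro conjI)
    show "k j \<le> CARD('n)"
      unfolding k_def using range by (intro Least_le) auto
    show "b $ j < real (partial (Suc (k j)) j)"
      unfolding k_def by (rule LeastI[of _ "CARD('n)"]) (use range in auto)
    show "real (partial (k j) j) \<le> b $ j"
    proof (cases "k j")
      case 0
      then show ?thesis using range by (simp add: partial_def)
    next
      case (Suc m)
      then show ?thesis
        using not_less_Least[of m "\<lambda>m. b $ j < real (partial (Suc m) j)"] by (simp add: k_def)
    qed
  qed
  then have "in_slots k b"
    by (simp add: in_slots_def)
  then show thesis by (rule that)
qed

section \<open>Type vector and row content read off the slots of a lattice point\<close>

context
  fixes \<delta> b :: "real^'n" and k :: "'n \<Rightarrow> nat"
  assumes b: "b \<in> integer_points" and \<delta>: "\<And>j. \<delta> $ j < 0 \<and> \<bar>\<delta> $ j\<bar> < 1"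
    and k: "in_slots k b"
begin

text \<open>The half-open slots are disjoint, so \<open>cell k\<close> is the only cell whose
  translate contains \<open>b\<close> and the definite description is well defined.\<close>

lemma components_at_eq: "components_at A \<omega> \<delta> b = restrict (component k) {..CARD('n)}"
proof -
  have in_cell: "b \<in> translate \<delta> (cell k') \<longleftrightarrow> in_slots k' b" if "\<forall>j. k' j \<le> CARD('n)" for k'
    using that in_translate_iff[OF b \<delta>] by (simp add: cell_def in_slots_def)
  have kn: "\<forall>j. k j \<le> CARD('n)"
    using k by (simp add: in_slots_def)
  let ?X = "(cell k, restrict (component k) {..CARD('n)})"
  have "X \<in> full_cells A \<omega> \<and> b \<in> translate \<delta> (fst X) \<longleftrightarrow> X = ?X" for X
  proof
    assume X: "X \<in> full_cells A \<omega> \<and> b \<in> translate \<delta> (fst X)"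
    then obtain k' where k': "\<forall>j. k' j \<le> CARD('n)" "X = (cell k', restrict (component k') {..CARD('n)})"
      unfolding full_cells_eq by blast
    then have "in_slots k' b"
      using X in_cell by simp
    then show "X = ?X"
      using k' in_slots_unique[OF k] by blast
  next
    assume X: "X = ?X"
    then have "X \<in> full_cells A \<omega>"
      unfolding full_cells_eq using kn by blast
    then show "X \<in> full_cells A \<omega> \<and> b \<in> translate \<delta> (fst X)"
      using X in_cell[OF kn] k by simp
  qed
  then have "(THE X. X \<in> full_cells A \<omega> \<and> b \<in> translate \<delta> (fst X)) = ?X"
    by simp
  then show ?thesis
    unfolding components_at_def case_prod_unfold by simp
qed

text \<open>Since \<open>a i j\<close> is positive, \<open>component k i\<close> has positive length
  in direction \<open>j\<close> exactly if \<open>k j\<close> selects \<open>i\<close>.\<close>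

lemma type_vector_eq:
  assumes "i \<le> CARD('n)"
  shows "type_vector A \<omega> \<delta> b i = int (card {j. k j = i})"
proof -
  have "{j. (if i < k j then real (a i j) else 0) < (if k j < i then 0 else real (a i j))} = {j. k j = i}"
    using a_pos[OF assms] by (auto split: if_splits)
  then show ?thesis
    unfolding type_vector_def components_at_eq component_def
    using assms by (simp add: aff_dim_cbox_cart)
qed

lemma sum_type_vector:
  assumes "I \<le> CARD('n)"
  shows "(\<Sum>i=0..I. type_vector A \<omega> \<delta> b i) = int (card {j. k j \<le> I})"
proof -
  have "(\<Sum>i=0..I. type_vector A \<omega> \<delta> b i) = (\<Sum>i=0..I. int (card {j. k j = i}))"
    using assms by (intro sum.cong type_vector_eq) auto
  also have "\<dots> = int (card (\<Union>i\<in>{0..I}. {j. k j = i}))"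
    by (subst card_UN_disjoint) auto
  also have "(\<Union>i\<in>{0..I}. {j. k j = i}) = {j. k j \<le> I}"
    by auto
  finally show ?thesis .
qed

lemma greedy_iff:
  assumes "b \<in> shifted_points A \<delta>"
  shows "b \<in> greedy_points A \<omega> \<delta> \<longleftrightarrow> (\<forall>I<CARD('n). card {j. k j \<le> I} \<le> Suc I)"
proof -
  have "(\<Sum>i=0..I. type_vector A \<omega> \<delta> b i) \<le> int I + 1 \<longleftrightarrow> card {j. k j \<le> I} \<le> Suc I"
    if "I < CARD('n)" for I
    using that by (subst sum_type_vector) auto
  then show ?thesis
    using assms by (simp add: greedy_points_def)
qed

text \<open>A zero of the type vector is an index missed by \<open>k\<close>, so \<open>r\<close> is
  the largest missed index.\<close>

lemma row_index_props:
  defines "r \<equiv> row_index A \<omega> \<delta> b"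
  shows "r \<le> CARD('n)" and "r \<notin> range k" and "\<And>i. r < i \<Longrightarrow> i \<le> CARD('n) \<Longrightarrow> i \<in> range k"
proof -
  let ?Z = "{i \<in> {0..CARD('n)}. type_vector A \<omega> \<delta> b i = 0}"
  have Z: "?Z = {0..CARD('n)} - range k"
    by (auto simp: type_vector_eq)
  \<comment> \<open>Pigeonhole: \<open>k\<close> takes at most \<open>CARD('n)\<close> values among
    one more index, so the maximum is over a nonempty set.\<close>
  have "card (range k) < card {0..CARD('n)}"
    using card_image_le[of UNIV k] by simp
  then have "\<not> {0..CARD('n)} \<subseteq> range k"
    using card_mono[of "range k" "{0..CARD('n)}"] by fastforce
  then have "?Z \<noteq> {}"
    unfolding Z by blast
  then have "r \<in> ?Z"
    unfolding r_def row_index_def by (intro Max_in) auto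
  then show "r \<le> CARD('n)" "r \<notin> range k"
    unfolding Z by auto
  fix i assume "r < i" "i \<le> CARD('n)"
  moreover have "i \<notin> ?Z"
  proof
    assume "i \<in> ?Z"
    then have "i \<le> r"
      unfolding r_def row_index_def by (intro Max_ge) auto
    with \<open>r < i\<close> show False by simp
  qed
  ultimately show "i \<in> range k"
    unfolding Z by auto
qed

text \<open>As \<open>k\<close> misses \<open>r\<close>, support \<open>r\<close> is pinned to one
  end in every direction and its component is a single vertex.\<close>

lemma row_point_nth:
  defines "r \<equiv> row_index A \<omega> \<delta> b"
  shows "row_point A \<omega> \<delta> b $ j = (if r < k j then real (a r j) else 0)"
proof -
  have "(\<chi> j. if k j < r then 0 else real (a r j)) = (\<chi> j. if r < k j then real (a r j) else 0)"
    using row_index_props(2) by (auto simp: vec_eq_iff r_def not_less le_less) (metis rangeI)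
  then have "component k r = {\<chi> j. if r < k j then real (a r j) else 0}"
    by (simp add: component_def)
  then have "components_at A \<omega> \<delta> b r = {\<chi> j. if r < k j then real (a r j) else 0}"
    using row_index_props(1) by (simp add: components_at_eq r_def)
  then have "row_point A \<omega> \<delta> b = (\<chi> j. if r < k j then real (a r j) else 0)"
    unfolding row_point_def r_def by simp
  then show ?thesis by simp
qed

end


section \<open>Moves along a row\<close>

text \<open>Turns a lower estimate for a coordinate of a moved point into one for its slot.\<close>

lemma slot_le:
  assumes "in_slots k' b'" and "real (partial m j) \<le> b' $ j"
  shows "m \<le> k' j"
proof (rule ccontr)
  assume "\<not> m \<le> k' j"
  then have "partial (Suc (k' j)) j \<le> partial m j"
    by (intro partial_mono) simp
  moreover have "b' $ j < real (partial (Suc (k' j)) j)"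
    using assms(1) by (simp add: in_slots_def)
  ultimately show False
    using assms(2) by linarith
qed

lemma greedy_move:
  assumes a_mono: "\<And>i j. Suc i < CARD('n) \<Longrightarrow> a i j \<le> a (Suc i) j"
    and \<delta>: "\<And>j. \<delta> $ j < 0 \<and> \<bar>\<delta> $ j\<bar> < 1"
    and b: "b \<in> greedy_points A \<omega> \<delta>"
    and b': "b' \<in> shifted_points A \<delta>"
    and x: "x \<in> A (row_index A \<omega> \<delta> b)"
    and move: "b' = b - row_point A \<omega> \<delta> b + x"
  shows "b' \<in> greedy_points A \<omega> \<delta>"
proof -
  define r where "r = row_index A \<omega> \<delta> b"
  have bs: "b \<in> shifted_points A \<delta>"
    using b by (simp add: greedy_points_def)
  then have bi: "b \<in> integer_points" and bi': "b' \<in> integer_points"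
    using b' by (auto simp: shifted_points_def)
  obtain k where k: "in_slots k b"
    using shifted_points_in_slots[OF bs \<delta>] .
  obtain k' where k': "in_slots k' b'"
    using shifted_points_in_slots[OF b' \<delta>] .
  note props = row_index_props[OF bi \<delta> k, folded r_def]
  have kn: "k j \<le> CARD('n)" for j
    using k by (simp add: in_slots_def)
  have bk: "real (partial (k j) j) \<le> b $ j" for j
    using k by (simp add: in_slots_def)
  have x0: "0 \<le> x $ j" for j
    using x by (simp add: box_support_def)
  have b'j: "b' $ j = b $ j - (if r < k j then real (a r j) else 0) + x $ j" for j
    by (simp add: move row_point_nth[OF bi \<delta> k] r_def)
  \<comment> \<open>The row point has coordinate 0 here and \<open>x\<close> is nonnegative, so the
    coordinate does not decrease.\<close>
  have below: "k j \<le> k' j" if "k j < r" for j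
    using that bk[of j] x0[of j] b'j[of j] by (intro slot_le[OF k']) simp
  have above: "k j - 1 \<le> k' j" if j: "r < k j" for j
  proof (cases "k j - 1 = r")
    case True
    \<comment> \<open>The drop is at most \<open>a r j\<close>, exactly the length of segment
      \<open>r\<close>, which lies directly below segment \<open>k j\<close>.\<close>
    have "k j = Suc r" using True j by simp
    then show ?thesis
      using bk[of j] x0[of j] b'j[of j] by (intro slot_le[OF k']) (simp add: partial_Suc)
  next
    case False
    \<comment> \<open>Segment \<open>m\<close> lies directly below segment \<open>k j\<close>. As
      \<open>m < CARD('n)\<close>, monotonicity can be chained from \<open>r\<close> to
      \<open>m\<close>, so the drop \<open>a r j\<close> is at most the length of segment
      \<open>m\<close>.\<close>
    then obtain m where m: "k j = Suc m" "r < m" "m < CARD('n)"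
      using j kn[of j] by (cases "k j") auto
    have "a r j \<le> a m j"
      using m(2,3)
    proof (induction m)
      case (Suc m)
      then show ?case
        using a_mono[of m j] by (cases "r = m") force+
    qed simp
    then show ?thesis
      using m bk[of j] x0[of j] b'j[of j] by (intro slot_le[OF k']) (simp add: partial_Suc)
  qed
  have kr: "k j \<noteq> r" for j
    using props(2) by auto
  have "card {j. k' j \<le> I} \<le> Suc I" if I: "I < CARD('n)" for I
  proof (cases "I < r")
    case True
    \<comment> \<open>If \<open>k j > r\<close>, then \<open>k' j \<ge> k j - 1 \<ge> r > I\<close>.
      So only coordinates with \<open>k j < r\<close> are counted, and their slots have not gone
      down.\<close>
    have "{j. k' j \<le> I} \<subseteq> {j. k j \<le> I}"
    proof
      fix j assume "j \<in> {j. k' j \<le> I}"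
      then show "j \<in> {j. k j \<le> I}"
        using True above[of j] below[of j] kr[of j] by (cases "k j < r") auto
    qed
    then have "card {j. k' j \<le> I} \<le> card {j. k j \<le> I}"
      by (intro card_mono) auto
    also have "\<dots> \<le> Suc I"
      using b I greedy_iff[OF bi \<delta> k bs] by blast
    finally show ?thesis .
  next
    case False
    \<comment> \<open>No slot drops by more than one, which costs the shift from \<open>I\<close> to
      \<open>Suc I\<close>.\<close>
    have "{j. k' j \<le> I} \<subseteq> {j. k j \<le> Suc I}"
    proof
      fix j assume "j \<in> {j. k' j \<le> I}"
      then show "j \<in> {j. k j \<le> Suc I}"
        using False above[of j] below[of j] kr[of j] by (cases "k j < r") auto
    qed
    then have "card {j. k' j \<le> I} \<le> card {j. k j \<le> Suc I}"
      by (intro card_mono) auto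
    moreover have "card {j. k j \<le> Suc I} + card {j. Suc I < k j} = CARD('n)"
      by (subst card_Un_disjoint[symmetric]) (auto intro!: arg_cong[of _ _ card])
    \<comment> \<open>Every index above \<open>r\<close> is a value of \<open>k\<close>, so the
      indices above \<open>Suc I\<close> use up at least this many coordinates and leave at most
      \<open>Suc I\<close> for the rest.\<close>
    moreover have "CARD('n) - Suc I \<le> card {j. Suc I < k j}"
    proof -
      have "{Suc I<..CARD('n)} \<subseteq> k ` {j. Suc I < k j}"
      proof
        fix i assume i: "i \<in> {Suc I<..CARD('n)}"
        then have "i \<in> range k"
          using False by (intro props(3)) auto
        with i show "i \<in> k ` {j. Suc I < k j}"
          by auto
      qed
      then have "card {Suc I<..CARD('n)} \<le> card (k ` {j. Suc I < k j})"
        by (intro card_mono) auto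
      also have "\<dots> \<le> card {j. Suc I < k j}"
        by (intro card_image_le) auto
      finally show ?thesis by simp
    qed
    ultimately show ?thesis
      using I by linarith
  qed
  then show ?thesis
    using greedy_iff[OF bi' \<delta> k' b'] by blast
qed

end

section \<open>Conclusion for admissible liftings and shifts\<close>

theorem theorem3p9:
  fixes a :: "nat \<Rightarrow> 'n::finite \<Rightarrow> nat" and v :: "real^'n"
  assumes a_pos: "\<And>i j. i \<le> CARD('n) \<Longrightarrow> 0 < a i j"
    and a_mono: "\<And>i j. Suc i < CARD('n) \<Longrightarrow> a i j \<le> a (Suc i) j"
    and v_neg: "\<And>j. v $ j < 0"
  shows "\<exists>\<epsilon>>0. \<forall>lam :: nat \<Rightarrow> real.
           (\<forall>i<CARD('n). lam (Suc i) < lam i) \<and> 0 \<le> lam CARD('n) \<and> lam 0 < \<epsilon> \<longrightarrow>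
           (\<exists>\<eta>>0. \<forall>\<delta> :: real^'n.
              (\<forall>j. \<delta> $ j < 0 \<and> \<bar>\<delta> $ j\<bar> < \<eta>) \<and>
              generic_shift (box_support a) (linear_lifting lam v) \<delta> \<longrightarrow>
              (\<forall>b \<in> greedy_points (box_support a) (linear_lifting lam v) \<delta>.
               \<forall>b' \<in> shifted_points (box_support a) \<delta>
                      - greedy_points (box_support a) (linear_lifting lam v) \<delta>.
                 b' \<notin> (\<lambda>x. b - row_point (box_support a) (linear_lifting lam v) \<delta> b + x) `
                        box_support a (row_index (box_support a) (linear_lifting lam v) \<delta> b)))"
proof (rule exI[of _ 1], intro conjI allI impI)
  fix lam :: "nat \<Rightarrow> real"
  assume lam: "(\<forall>i<CARD('n). lam (Suc i) < lam i) \<and> 0 \<le> lam CARD('n) \<and> lam 0 < 1"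
  interpret box_subdivision a v lam
    using a_pos v_neg lam by unfold_locales auto
  show "\<exists>\<eta>>0. \<forall>\<delta> :: real^'n.
              (\<forall>j. \<delta> $ j < 0 \<and> \<bar>\<delta> $ j\<bar> < \<eta>) \<and> generic_shift A \<omega> \<delta> \<longrightarrow>
              (\<forall>b \<in> greedy_points A \<omega> \<delta>.
               \<forall>b' \<in> shifted_points A \<delta> - greedy_points A \<omega> \<delta>.
                 b' \<notin> (\<lambda>x. b - row_point A \<omega> \<delta> b + x) ` A (row_index A \<omega> \<delta> b))"
  \<comment> \<open>The bound 1 is the lattice spacing: a shorter shift passes no further
    integer.\<close>
  proof (rule exI[of _ 1], intro conjI allI impI ballI notI)
    fix \<delta> b b' :: "real^'n"
    assume \<delta>: "(\<forall>j. \<delta> $ j < 0 \<and> \<bar>\<delta> $ j\<bar> < 1) \<and> generic_shift A \<omega> \<delta>"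
      and b: "b \<in> greedy_points A \<omega> \<delta>"
      and b': "b' \<in> shifted_points A \<delta> - greedy_points A \<omega> \<delta>"
      and "b' \<in> (\<lambda>x. b - row_point A \<omega> \<delta> b + x) ` A (row_index A \<omega> \<delta> b)"
    then obtain x where x: "x \<in> A (row_index A \<omega> \<delta> b)" "b' = b - row_point A \<omega> \<delta> b + x"
      by blast
    \<comment> \<open>Contrapositive form: a move from a greedy point that ends in a shifted lattice
      point ends in a greedy one.\<close>
    have "b' \<in> greedy_points A \<omega> \<delta>"
      by (rule greedy_move[OF a_mono _ b _ x]) (use \<delta> b' in auto)
    with b' show False by blast
  qed simp
qed simp

end
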